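(* There exist a group $G$ generated by a finite symmetric set $A$, a compact Polish space $X$, and an action of $G$ on $X$ by homeomorphisms that is highly topologically transitive but not topologically $\mu$-mixing for the uniform measure $\mu$ supported on $A$.
   Context: A subset $A$ of a group is symmetric if $A^{-1}=A$. A space is Polish if it is separable and completely metrizable. $\mu^{*n}$ is the $n$-fold convolution of $\mu$ with itself. For an action of $G$ on $X$ by homeomorphisms and $U,V\subseteq X$, let $N(U,V)=\{g\in G\mid g(U)\cap V\ne\emptyset\}$. The action is topologically transitive if $N(U,V)\neq\emptyset$ for all non-empty open $U,V$; highly topologically transitive if the diagonal action of $G$ on $X^k$ is topologically transitive for all $k\in\mathbb N$ (equivalently, for all $k$ and all non-empty open $U_1,\dots,U_k,V_1,\dots,V_k\subseteq X$ there is $g\in G$ with $g(U_i)\cap V_i\ne\emptyset$ for all $i$); and topologically $\mu$-mixing if $\lim_{n\to\infty}\mu^{*n}(N(U,V))=1$ for all non-empty open $U,V\subseteq X$. *)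

theory Defs
  imports
    "HOL-Probability.Probability"
    "HOL-Algebra.Generated_Groups"
    "HOL-Algebra.Group_Action"
begin

definition polish_space :: "'x topology \<Rightarrow> bool" where
  "polish_space X \<longleftrightarrow> separable_space X \<and> completely_metrizable_space X"

definition acts_by_homeomorphisms ::
    "('g, 'b) monoid_scheme \<Rightarrow> 'x topology \<Rightarrow> ('g \<Rightarrow> 'x \<Rightarrow> 'x) \<Rightarrow> bool" where
  "acts_by_homeomorphisms G X \<phi> \<longleftrightarrow>
     group_action G (topspace X) \<phi> \<and> (\<forall>g\<in>carrier G. homeomorphic_map X X (\<phi> g))"

definition hitting_set ::
    "('g, 'b) monoid_scheme \<Rightarrow> ('g \<Rightarrow> 'x \<Rightarrow> 'x) \<Rightarrow> 'x set \<Rightarrow> 'x set \<Rightarrow> 'g set" where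
  "hitting_set G \<phi> U V = {g \<in> carrier G. \<phi> g ` U \<inter> V \<noteq> {}}"

definition topologically_transitive ::
    "('g, 'b) monoid_scheme \<Rightarrow> 'x topology \<Rightarrow> ('g \<Rightarrow> 'x \<Rightarrow> 'x) \<Rightarrow> bool" where
  "topologically_transitive G X \<phi> \<longleftrightarrow>
     (\<forall>U V. openin X U \<and> U \<noteq> {} \<and> openin X V \<and> V \<noteq> {} \<longrightarrow> hitting_set G \<phi> U V \<noteq> {})"

text \<open>The power \<open>X\<^sup>k\<close> consists of the functions on \<open>{..<k}\<close> (extended by \<open>undefined\<close>)
  with values in \<open>X\<close>.\<close>

definition power_space :: "nat \<Rightarrow> 'x topology \<Rightarrow> (nat \<Rightarrow> 'x) topology" where
  "power_space k X = product_topology (\<lambda>_. X) {..<k}"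

definition diagonal_action ::
    "nat \<Rightarrow> 'x topology \<Rightarrow> ('g \<Rightarrow> 'x \<Rightarrow> 'x) \<Rightarrow> 'g \<Rightarrow> (nat \<Rightarrow> 'x) \<Rightarrow> nat \<Rightarrow> 'x" where
  "diagonal_action k X \<phi> g = (\<lambda>x \<in> topspace (power_space k X). \<lambda>i \<in> {..<k}. \<phi> g (x i))"

text \<open>The exponent \<open>k = 0\<close> is included; its condition holds for every action of a group,
  since \<open>X\<^sup>0\<close> is a point.\<close>

definition highly_topologically_transitive ::
    "('g, 'b) monoid_scheme \<Rightarrow> 'x topology \<Rightarrow> ('g \<Rightarrow> 'x \<Rightarrow> 'x) \<Rightarrow> bool" where
  "highly_topologically_transitive G X \<phi> \<longleftrightarrow>
     (\<forall>k. topologically_transitive G (power_space k X) (diagonal_action k X \<phi>))"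

text \<open>Probability measures on a countable discrete group are probability mass functions.\<close>

definition convolution_pmf ::
    "('g, 'b) monoid_scheme \<Rightarrow> 'g pmf \<Rightarrow> 'g pmf \<Rightarrow> 'g pmf" where
  "convolution_pmf G \<mu> \<nu> = map_pmf (\<lambda>(g, h). g \<otimes>\<^bsub>G\<^esub> h) (pair_pmf \<mu> \<nu>)"

primrec convolution_power ::
    "('g, 'b) monoid_scheme \<Rightarrow> 'g pmf \<Rightarrow> nat \<Rightarrow> 'g pmf" where
  "convolution_power G \<mu> 0 = return_pmf \<one>\<^bsub>G\<^esub>"
| "convolution_power G \<mu> (Suc n) = convolution_pmf G \<mu> (convolution_power G \<mu> n)"

definition topologically_mixing ::
    "('g, 'b) monoid_scheme \<Rightarrow> 'g pmf \<Rightarrow> 'x topology \<Rightarrow> ('g \<Rightarrow> 'x \<Rightarrow> 'x) \<Rightarrow> bool" where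
  "topologically_mixing G \<mu> X \<phi> \<longleftrightarrow>
     (\<forall>U V. openin X U \<and> U \<noteq> {} \<and> openin X V \<and> V \<noteq> {} \<longrightarrow>
        (\<lambda>n. measure_pmf.prob (convolution_power G \<mu> n) (hitting_set G \<phi> U V)) \<longlonglongrightarrow> 1)"

definition symmetric_subset :: "('g, 'b) monoid_scheme \<Rightarrow> 'g set \<Rightarrow> bool" where
  "symmetric_subset G A \<longleftrightarrow> A \<subseteq> carrier G \<and> set_inv\<^bsub>G\<^esub> A = A"

end

theory Submission
  imports Defs
begin

text \<open>
  The group is \<open>\<int>\<close> with the generators \<open>\<plusminus>1\<close>, and the space is a spacing shift: for a set
  \<open>P\<close> of integers, the subshift of all \<open>x \<in> {0,1}\<^sup>\<int>\<close> in which any two distinct occurrences of the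
  symbol \<open>1\<close> differ by an element of \<open>P\<close>.

  High transitivity only asks that \<open>P = -P\<close> contain arbitrarily long intervals
  (\<open>spacing_shift_highly_transitive\<close>). A non-empty open subset of a power of the shift is detected on
  a finite window, and two patterns on a window can be put into one configuration, a
  distance \<open>z\<close> apart, as soon as \<open>P\<close> contains a long enough interval around \<open>z\<close>
  (\<open>spacing_shift_glue\<close>). The same \<open>z\<close> serves any finite number of pairs of patterns.

  Mixing, on the other hand, forces \<open>P\<close> to be large for the random walk. If \<open>U\<close> is the set of
  configurations with a \<open>1\<close> at the origin, then \<open>N(U,U) \<subseteq> P \<union> {0}\<close>. Let \<open>P\<close> be the union of the blocks
  \<open>[a\<^sub>k, 2a\<^sub>k]\<close> and of their negatives, where \<open>a\<^sub>k\<^sub>+\<^sub>1 > 16a\<^sub>k\<^sup>2\<close>. At time \<open>n = 16a\<^sub>k\<^sup>2\<close> the simple random walk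
  cannot have reached the next block, so it can lie in \<open>P \<union> {0}\<close> only within
  distance \<open>2a\<^sub>k = \<surd>n / 2\<close> of the origin, and a second and fourth moment
  estimate bounds the probability of that by \<open>4/5\<close> (\<open>walk_anticoncentration\<close>).
\<close>

section \<open>The integers and their simple random walk\<close>

text \<open>
  The additive group of integers, transported to \<open>nat\<close> along the bijection \<open>int_encode\<close>.
\<close>

definition Zn :: "nat monoid" where
  "Zn = \<lparr>carrier = UNIV,
          mult = (\<lambda>g h. int_encode (int_decode g + int_decode h)),
          one = int_encode 0\<rparr>"

definition unit_steps :: "nat set" where
  "unit_steps = {int_encode 1, int_encode (-1)}"

lemma Zn_simps [simp]:
  "carrier Zn = UNIV"
  "g \<otimes>\<^bsub>Zn\<^esub> h = int_encode (int_decode g + int_decode h)"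
  "\<one>\<^bsub>Zn\<^esub> = int_encode 0"
  by (simp_all add: Zn_def)

lemma group_Zn: "group Zn"
proof (rule groupI)
  fix g assume "g \<in> carrier Zn"
  show "\<exists>h\<in>carrier Zn. h \<otimes>\<^bsub>Zn\<^esub> g = \<one>\<^bsub>Zn\<^esub>"
    by (rule bexI[of _ "int_encode (- int_decode g)"]) auto
qed (auto simp: algebra_simps)

lemma inv_Zn [simp]: "inv\<^bsub>Zn\<^esub> g = int_encode (- int_decode g)"
proof -
  interpret group Zn by (rule group_Zn)
  show ?thesis by (rule inv_equality) auto
qed

lemma finite_unit_steps: "finite unit_steps"
  and unit_steps_nonempty: "unit_steps \<noteq> {}"
  and card_unit_steps: "card unit_steps = 2"
  and sum_unit_steps: "sum f unit_steps = f (int_encode 1) + f (int_encode (-1))"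
proof -
  have "int_encode 1 \<noteq> int_encode (-1)" by (simp only: int_encode_eq)
  then show "finite unit_steps" "unit_steps \<noteq> {}" "card unit_steps = 2"
    "sum f unit_steps = f (int_encode 1) + f (int_encode (-1))"
    unfolding unit_steps_def by simp_all
qed

lemma symmetric_unit_steps: "symmetric_subset Zn unit_steps"
  by (auto simp: symmetric_subset_def unit_steps_def SET_INV_def)

lemma generate_unit_steps: "generate Zn unit_steps = carrier Zn"
proof -
  have "int_encode z \<in> generate Zn unit_steps" for z
  proof (induction z rule: int_induct[where k = 0])
    case base
    show ?case using generate.one[of Zn unit_steps] by simp
  next
    case (step1 i)
    have "int_encode 1 \<in> generate Zn unit_steps"
      by (rule generate.incl) (simp add: unit_steps_def)
    from generate.eng[OF step1(2) this] show ?case by simp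
  next
    case (step2 i)
    have "int_encode (-1) \<in> generate Zn unit_steps"
      by (rule generate.incl) (simp add: unit_steps_def)
    from generate.eng[OF step2(2) this] show ?case by simp
  qed
  then have "g \<in> generate Zn unit_steps" for g
    by (metis int_decode_inverse)
  then show ?thesis by auto
qed

abbreviation walk :: "nat \<Rightarrow> nat pmf" where
  "walk \<equiv> convolution_power Zn (pmf_of_set unit_steps)"

abbreviation walk_mean :: "nat \<Rightarrow> (int \<Rightarrow> real) \<Rightarrow> real" where
  "walk_mean n f \<equiv> measure_pmf.expectation (walk n) (\<lambda>g. f (int_decode g))"

lemma convolution_pmf_bind:
  "convolution_pmf G \<mu> \<nu> = \<mu> \<bind> (\<lambda>g. map_pmf (\<lambda>h. g \<otimes>\<^bsub>G\<^esub> h) \<nu>)"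
  by (simp add: convolution_pmf_def pair_pmf_def map_bind_pmf map_pmf_def bind_assoc_pmf
      bind_return_pmf)

lemma finite_set_walk: "finite (set_pmf (walk n))"
proof (induction n)
  case (Suc n)
  then show ?case by (simp add: convolution_pmf_bind finite_unit_steps unit_steps_nonempty)
qed simp

lemma integrable_walk [simp]: "integrable (measure_pmf (walk n)) (f :: nat \<Rightarrow> real)"
  by (rule integrable_measure_pmf_finite[OF finite_set_walk])

lemma walk_mean_0: "walk_mean 0 f = f 0"
  by simp

text \<open>
  Conditioning on the most recent step turns every moment computation into a one-line recursion,
  without any formula for the distribution of the walk.
\<close>

lemma walk_mean_Suc:
  "walk_mean (Suc n) f = walk_mean n (\<lambda>z. (f (z + 1) + f (z - 1)) / 2)"
proof -
  have "walk_mean (Suc n) f =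
    (\<Sum>a\<in>unit_steps. measure_pmf.expectation (map_pmf (\<lambda>h. a \<otimes>\<^bsub>Zn\<^esub> h) (walk n))
        (\<lambda>g. f (int_decode g)) /\<^sub>R real (card unit_steps))"
    unfolding convolution_power.simps convolution_pmf_bind
    by (rule pmf_expectation_bind_pmf_of_set)
       (simp_all add: finite_unit_steps unit_steps_nonempty finite_set_walk)
  also have "\<dots> = (walk_mean n (\<lambda>z. f (z + 1)) + walk_mean n (\<lambda>z. f (z - 1))) / 2"
    by (simp add: sum_unit_steps card_unit_steps field_simps)
  finally show ?thesis by simp
qed

lemma walk_second_moment: "walk_mean n (\<lambda>z. real_of_int z ^ 2) = real n"
proof (induction n)
  case 0
  show ?case by (simp add: walk_mean_0)
next
  case (Suc n)
  have "walk_mean (Suc n) (\<lambda>z. real_of_int z ^ 2) = walk_mean n (\<lambda>z. real_of_int z ^ 2 + 1)"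
    unfolding walk_mean_Suc[of n "\<lambda>z. real_of_int z ^ 2"]
    by (rule Bochner_Integration.integral_cong) (auto simp: power2_eq_square field_simps)
  then show ?case using Suc by simp
qed

lemma walk_fourth_moment:
  "walk_mean n (\<lambda>z. real_of_int z ^ 4) = 3 * real n ^ 2 - 2 * real n"
proof (induction n)
  case 0
  show ?case by (simp add: walk_mean_0)
next
  case (Suc n)
  have "walk_mean (Suc n) (\<lambda>z. real_of_int z ^ 4) =
      walk_mean n (\<lambda>z. real_of_int z ^ 4 + 6 * real_of_int z ^ 2 + 1)"
    unfolding walk_mean_Suc[of n "\<lambda>z. real_of_int z ^ 4"]
    by (rule Bochner_Integration.integral_cong)
      (auto simp: power4_eq_xxxx power2_eq_square field_simps)
  also have "\<dots> = (3 * real n ^ 2 - 2 * real n) + 6 * real n + 1"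
    using Suc walk_second_moment[of n] by simp
  finally show ?case by (simp add: power2_eq_square algebra_simps)
qed

lemma walk_bounded: "g \<in> set_pmf (walk n) \<Longrightarrow> \<bar>int_decode g\<bar> \<le> int n"
proof (induction n arbitrary: g)
  case (Suc n)
  from Suc.prems obtain s h where "s \<in> unit_steps" "h \<in> set_pmf (walk n)"
    "g = int_encode (int_decode s + int_decode h)"
    by (auto simp: convolution_pmf_bind finite_unit_steps unit_steps_nonempty)
  with Suc.IH[of h] show ?case by (auto simp: unit_steps_def)
qed simp

text \<open>
  A Paley-Zygmund argument. With \<open>t = z\<^sup>2 / n\<close>, the function \<open>t - t\<^sup>2 / 6\<close> has mean at least \<open>1/2\<close>
  by the two moments, never exceeds \<open>3/2\<close>, and is at most \<open>1/4\<close> when \<open>\<bar>z\<bar> \<le> m\<close>. Too much mass on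
  \<open>\<bar>z\<bar> \<le> m\<close> would therefore make the mean too small.
\<close>

lemma walk_anticoncentration:
  fixes m :: int
  assumes n: "0 < n" and m: "4 * m ^ 2 \<le> int n"
  shows "measure_pmf.prob (walk n) {g. \<bar>int_decode g\<bar> \<le> m} \<le> 4 / 5"
proof -
  define I where "I z = (indicator {z. \<bar>z\<bar> \<le> m} z :: real)" for z :: int
  define f where "f z = real_of_int z ^ 2 / n - real_of_int z ^ 4 / (6 * real n ^ 2)" for z :: int
  have np: "real n > 0" using n by simp
  have le: "f z \<le> 3 / 2 - 5 / 4 * I z" for z
  proof -
    define t where "t = real_of_int z ^ 2 / n"
    have f: "f z = t - t ^ 2 / 6"
      by (simp add: f_def t_def power_divide flip: power_mult)
    have "t \<le> 1 / 4" if "\<bar>z\<bar> \<le> m"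
    proof -
      have "z ^ 2 \<le> m ^ 2" using that by (simp add: abs_le_square_iff[symmetric])
      then have "4 * z ^ 2 \<le> int n" using m by linarith
      then have "real_of_int (4 * z ^ 2) \<le> real_of_int (int n)" by (simp only: of_int_le_iff)
      then show ?thesis using np by (simp add: t_def field_simps)
    qed
    \<comment> \<open>The parabola has its maximum at \<open>t = 3\<close>.\<close>
    moreover have "t - t ^ 2 / 6 \<le> 3 / 2"
      using zero_le_power2[of "t - 3"] by (simp add: power2_eq_square field_simps)
    moreover have "t - t ^ 2 / 6 \<le> t" by simp
    ultimately have "t - t ^ 2 / 6 \<le> (if \<bar>z\<bar> \<le> m then 1 / 4 else 3 / 2)"
      by (cases "\<bar>z\<bar> \<le> m") (simp_all only: if_True if_False, meson order_trans)
    then show ?thesis unfolding f I_def by (simp split: if_splits)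
  qed
  have "1 / 2 \<le> walk_mean n f"
  proof -
    have "walk_mean n f = real n / n - (3 * real n ^ 2 - 2 * real n) / (6 * real n ^ 2)"
      unfolding f_def using walk_second_moment[of n] walk_fourth_moment[of n] by simp
    also have "\<dots> \<ge> 1 / 2" using np by (simp add: field_simps power2_eq_square)
    finally show ?thesis .
  qed
  also have "walk_mean n f \<le> walk_mean n (\<lambda>z. 3 / 2 - 5 / 4 * I z)"
    by (rule integral_mono; (rule le | rule integrable_walk))
  also have "\<dots> = 3 / 2 - 5 / 4 * walk_mean n I" by simp
  also have "walk_mean n I = measure_pmf.prob (walk n) {g. \<bar>int_decode g\<bar> \<le> m}"
  proof -
    have "walk_mean n I = measure_pmf.expectation (walk n) (indicator {g. \<bar>int_decode g\<bar> \<le> m})"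
      by (rule Bochner_Integration.integral_cong) (auto simp: I_def indicator_def)
    then show ?thesis by simp
  qed
  finally show ?thesis by simp
qed

section \<open>Spacing shifts\<close>

text \<open>
  Coordinates are indexed by codes of integers, so that a configuration on \<open>\<int>\<close> is a function on \<open>nat\<close>.
  The condition for the ordered pairs \<open>(i, j)\<close> and \<open>(j, i)\<close> together means that only elements \<open>p\<close> of \<open>P\<close>
  with \<open>-p \<in> P\<close> occur as spacings.
\<close>

definition spacing_shift :: "int set \<Rightarrow> (nat \<Rightarrow> real) set" where
  "spacing_shift P = {x. (\<forall>i. x i \<in> {0, 1}) \<and>
     (\<forall>i j. x i = 1 \<longrightarrow> x j = 1 \<longrightarrow> i \<noteq> j \<longrightarrow> int_decode i - int_decode j \<in> P)}"

definition translate :: "int \<Rightarrow> (nat \<Rightarrow> real) \<Rightarrow> nat \<Rightarrow> real" where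
  "translate z x = (\<lambda>i. x (int_encode (int_decode i - z)))"

text \<open>
  The restriction makes each map extensional, as the elements of \<open>BijGroup\<close> have to be.
\<close>

definition spacing_action :: "int set \<Rightarrow> nat \<Rightarrow> (nat \<Rightarrow> real) \<Rightarrow> nat \<Rightarrow> real" where
  "spacing_action P g = restrict (translate (int_decode g)) (spacing_shift P)"

lemma translate_add: "translate a (translate b x) = translate (a + b) x"
  by (simp add: translate_def algebra_simps)

lemma translate_0 [simp]: "translate 0 x = x"
  by (simp add: translate_def)

lemma translate_spacing_shift:
  assumes "x \<in> spacing_shift P" shows "translate z x \<in> spacing_shift P"
proof -
  have "int_decode i - int_decode j \<in> P"
    if "translate z x i = 1" "translate z x j = 1" "i \<noteq> j" for i j
  proof -
    let ?s = "\<lambda>i. int_encode (int_decode i - z)"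
    have "?s i \<noteq> ?s j" using that(3) by (metis diff_add_cancel int_encode_inverse int_decode_inverse)
    then have "int_decode (?s i) - int_decode (?s j) \<in> P"
      using assms that(1,2) unfolding spacing_shift_def translate_def by blast
    then show ?thesis by simp
  qed
  then show ?thesis using assms by (auto simp: spacing_shift_def translate_def)
qed

lemma closed_spacing_shift: "closed (spacing_shift P)"
proof -
  have coord: "continuous_on UNIV (\<lambda>x :: nat \<Rightarrow> real. x i)" for i
    by (intro continuous_on_product_coordinates)
  have value_set: "closed {x :: nat \<Rightarrow> real. x i = c}" for i c
    by (rule closed_Collect_eq[OF coord continuous_on_const])
  have "spacing_shift P = (\<Inter>i. {x. x i = 0} \<union> {x. x i = 1}) \<inter>
     (\<Inter>(i, j)\<in>{(i, j). i \<noteq> j \<and> int_decode i - int_decode j \<notin> P}. {x. x i = 0} \<union> {x. x j = 0})"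
  proof (intro equalityI subsetI)
    fix x assume "x \<in> spacing_shift P"
    then show "x \<in> (\<Inter>i. {x. x i = 0} \<union> {x. x i = 1}) \<inter>
     (\<Inter>(i, j)\<in>{(i, j). i \<noteq> j \<and> int_decode i - int_decode j \<notin> P}. {x. x i = 0} \<union> {x. x j = 0})"
      by (auto simp: spacing_shift_def)
  next
    fix x :: "nat \<Rightarrow> real"
    assume x: "x \<in> (\<Inter>i. {x. x i = 0} \<union> {x. x i = 1}) \<inter>
     (\<Inter>(i, j)\<in>{(i, j). i \<noteq> j \<and> int_decode i - int_decode j \<notin> P}. {x. x i = 0} \<union> {x. x j = 0})"
    then have "x i \<in> {0, 1}" for i by auto
    moreover have "int_decode i - int_decode j \<in> P" if "x i = 1" "x j = 1" "i \<noteq> j" for i j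
    proof (rule ccontr)
      assume "int_decode i - int_decode j \<notin> P"
      with x that(3) have "x i = 0 \<or> x j = 0" by blast
      with that show False by simp
    qed
    ultimately show "x \<in> spacing_shift P" by (auto simp: spacing_shift_def)
  qed
  then show ?thesis
    by (auto intro!: closed_Int closed_INT closed_Un value_set)
qed

lemma compact_spacing_shift: "compact_space (top_of_set (spacing_shift P))"
proof -
  have "compactin (product_topology (\<lambda>_. euclideanreal) UNIV) (\<Pi>\<^sub>E i\<in>(UNIV :: nat set). {0, 1 :: real})"
    unfolding compactin_PiE by simp
  then have "compact (\<Pi>\<^sub>E i\<in>(UNIV :: nat set). {0, 1 :: real})"
    by (simp add: euclidean_product_topology)
  moreover have "spacing_shift P = (\<Pi>\<^sub>E i\<in>UNIV. {0, 1}) \<inter> spacing_shift P"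
    by (auto simp: spacing_shift_def PiE_def)
  ultimately have "compact (spacing_shift P)"
    by (metis closed_spacing_shift compact_Int_closed)
  then show ?thesis by (simp add: compact_space_subtopology)
qed

lemma polish_spacing_shift: "polish_space (top_of_set (spacing_shift P))"
proof -
  have "completely_metrizable_space (top_of_set (spacing_shift P))"
    by (rule completely_metrizable_space_closedin[OF completely_metrizable_space_euclidean])
       (simp add: closed_spacing_shift)
  moreover have "separable_space (top_of_set (spacing_shift P))"
  proof -
    obtain T where "countable T" "T \<subseteq> spacing_shift P" "spacing_shift P \<subseteq> closure T"
      using separable by blast
    then show ?thesis unfolding separable_space_def
      by (intro exI[of _ T]) (auto simp: closure_of_subtopology Int_absorb1)
  qed
  ultimately show ?thesis by (simp add: polish_space_def)
qed

lemma spacing_shift_acts: "acts_by_homeomorphisms Zn (top_of_set (spacing_shift P)) (spacing_action P)"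
proof -
  let ?K = "spacing_shift P" and ?\<phi> = "spacing_action P"
  have inverse: "translate z (translate (- z) x) = x" "translate (- z) (translate z x) = x" for z x
    by (simp_all add: translate_add)
  have bij: "?\<phi> g \<in> Bij ?K" for g
  proof -
    have "bij_betw (translate (int_decode g)) ?K ?K"
      by (rule bij_betwI[where g = "translate (- int_decode g)"])
         (auto simp: inverse translate_spacing_shift)
    then show ?thesis by (simp add: Bij_def spacing_action_def)
  qed
  have "group_hom Zn (BijGroup ?K) ?\<phi>"
  proof (intro group_hom.intro group_hom_axioms.intro homI group_Zn group_BijGroup)
    fix g h
    show "?\<phi> g \<in> carrier (BijGroup ?K)" using bij by (simp add: BijGroup_def)
    show "?\<phi> (g \<otimes>\<^bsub>Zn\<^esub> h) = ?\<phi> g \<otimes>\<^bsub>BijGroup ?K\<^esub> ?\<phi> h"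
      using bij[of g] bij[of h]
      by (auto simp: BijGroup_def spacing_action_def compose_def translate_add
          translate_spacing_shift fun_eq_iff restrict_def)
  qed
  moreover have "homeomorphic_map (top_of_set ?K) (top_of_set ?K) (?\<phi> g)" for g
  proof -
    have cont: "continuous_on ?K (translate z)" for z
      unfolding translate_def by (intro continuous_on_coordinatewise_then_product
        continuous_on_subset[OF continuous_on_product_coordinates]) auto
    have "homeomorphic_maps (top_of_set ?K) (top_of_set ?K)
        (translate (int_decode g)) (translate (- int_decode g))"
      by (auto simp: homeomorphic_maps_def inverse cont translate_spacing_shift)
    then have "homeomorphic_map (top_of_set ?K) (top_of_set ?K) (translate (int_decode g))"
      by (rule homeomorphic_maps_imp_map)
    then show ?thesis
      by (rule homeomorphic_map_eq) (simp add: spacing_action_def)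
  qed
  ultimately show ?thesis by (simp add: acts_by_homeomorphisms_def group_action_def)
qed

lemma open_contains_window:
  fixes W :: "(nat \<Rightarrow> real) set"
  assumes "open W" "u \<in> W"
  shows "\<exists>M. \<forall>x. (\<forall>i. \<bar>int_decode i\<bar> \<le> M \<longrightarrow> x i = u i) \<longrightarrow> x \<in> W"
proof -
  have "openin (product_topology (\<lambda>_. euclideanreal) UNIV) W"
    using assms(1) by (simp add: euclidean_product_topology)
  from product_topology_open_contains_basis[OF this assms(2)]
  obtain X where X: "u \<in> (\<Pi>\<^sub>E i\<in>UNIV. X i)" "finite {i. X i \<noteq> UNIV}" "(\<Pi>\<^sub>E i\<in>UNIV. X i) \<subseteq> W"
    by auto
  define M where "M = Max (insert 0 ((\<lambda>i. \<bar>int_decode i\<bar>) ` {i. X i \<noteq> UNIV}))"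
  have window: "\<bar>int_decode i\<bar> \<le> M" if "X i \<noteq> UNIV" for i
    unfolding M_def using X(2) that by (intro Max_ge) auto
  have "x \<in> W" if "\<forall>i. \<bar>int_decode i\<bar> \<le> M \<longrightarrow> x i = u i" for x
  proof -
    have "x i \<in> X i" for i
      using window[of i] that X(1) by (cases "X i = UNIV") (auto simp: PiE_iff)
    then show ?thesis using X(3) by (auto simp: PiE_iff)
  qed
  then show ?thesis by blast
qed

text \<open>
  Finitely many coordinates have finitely many windows, so one window serves all of them.
\<close>

lemma power_open_contains_window:
  fixes K :: "(nat \<Rightarrow> real) set"
  assumes "openin (power_space k (top_of_set K)) U" "u \<in> U"
  shows "\<exists>M. \<forall>x\<in>topspace (power_space k (top_of_set K)).
           (\<forall>j<k. \<forall>i. \<bar>int_decode i\<bar> \<le> M \<longrightarrow> x j i = u j i) \<longrightarrow> x \<in> U"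
proof -
  from product_topology_open_contains_basis[OF assms[unfolded power_space_def]]
  obtain W where W: "u \<in> (\<Pi>\<^sub>E j\<in>{..<k}. W j)" "\<forall>j. openin (top_of_set K) (W j)"
    "(\<Pi>\<^sub>E j\<in>{..<k}. W j) \<subseteq> U" by blast
  have "\<forall>j. \<exists>M. j < k \<longrightarrow> (\<forall>x\<in>K. (\<forall>i. \<bar>int_decode i\<bar> \<le> M \<longrightarrow> x i = u j i) \<longrightarrow> x \<in> W j)"
  proof
    fix j
    show "\<exists>M. j < k \<longrightarrow> (\<forall>x\<in>K. (\<forall>i. \<bar>int_decode i\<bar> \<le> M \<longrightarrow> x i = u j i) \<longrightarrow> x \<in> W j)"
    proof (cases "j < k")
      case True
      obtain T where T: "open T" "W j = K \<inter> T" using W(2) by (auto simp: openin_open)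
      have "u j \<in> T" using W(1) True T(2) by auto
      from open_contains_window[OF T(1) this] show ?thesis using T(2) by blast
    qed simp
  qed
  from choice[OF this] obtain M where
    M: "\<And>j x. j < k \<Longrightarrow> x \<in> K \<Longrightarrow> (\<forall>i. \<bar>int_decode i\<bar> \<le> M j \<longrightarrow> x i = u j i) \<Longrightarrow> x \<in> W j"
    by blast
  define N where "N = Max (insert 0 (M ` {..<k}))"
  have N: "M j \<le> N" if "j < k" for j unfolding N_def using that by (intro Max_ge) auto
  have "x \<in> U" if x: "x \<in> topspace (power_space k (top_of_set K))"
    and agree: "\<forall>j<k. \<forall>i. \<bar>int_decode i\<bar> \<le> N \<longrightarrow> x j i = u j i" for x
  proof -
    have "x j \<in> W j" if "j < k" for j
    proof (rule M[OF that])
      show "x j \<in> K" using x that by (auto simp: power_space_def)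
      show "\<forall>i. \<bar>int_decode i\<bar> \<le> M j \<longrightarrow> x j i = u j i"
      proof (intro allI impI)
        fix i assume "\<bar>int_decode i\<bar> \<le> M j"
        with N[OF that] have "\<bar>int_decode i\<bar> \<le> N" by simp
        with agree that show "x j i = u j i" by blast
      qed
    qed
    then have "x \<in> (\<Pi>\<^sub>E j\<in>{..<k}. W j)" using x by (auto simp: power_space_def PiE_iff)
    then show ?thesis using W(3) by blast
  qed
  then show ?thesis by (intro exI[of _ N] ballI impI)
qed

text \<open>
  The witness is \<open>u\<close> on \<open>[-M, M]\<close>, the translate of \<open>v\<close> on \<open>[z - M, z + M]\<close>, and zero elsewhere.
  Spacings inside one window are inherited from \<open>u\<close> or \<open>v\<close>; spacings between the two windows lie
  within \<open>2M\<close> of \<open>z\<close> or of \<open>-z\<close>, hence in \<open>P\<close>. The windows are disjoint since \<open>z > 2M\<close>.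
\<close>

lemma spacing_shift_glue:
  assumes uv: "u \<in> spacing_shift P" "v \<in> spacing_shift P"
    and sym: "\<And>p. p \<in> P \<Longrightarrow> - p \<in> P"
    and z: "{z - 2 * M..z + 2 * M} \<subseteq> P" "2 * M < z"
  shows "\<exists>x\<in>spacing_shift P. \<forall>i. \<bar>int_decode i\<bar> \<le> M \<longrightarrow> x i = u i \<and> translate (- z) x i = v i"
proof -
  define x where "x i = (if \<bar>int_decode i\<bar> \<le> M then u i
      else if \<bar>int_decode i - z\<bar> \<le> M then translate z v i else 0)" for i
  have v': "translate z v \<in> spacing_shift P" by (rule translate_spacing_shift[OF uv(2)])
  have mixed: "int_decode j - int_decode i \<in> P"
    if "\<bar>int_decode i\<bar> \<le> M" "\<bar>int_decode j - z\<bar> \<le> M" for i j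
    using that by (intro subsetD[OF z(1)]) auto
  have "int_decode i - int_decode j \<in> P" if ij: "x i = 1" "x j = 1" "i \<noteq> j" for i j
  proof (cases "\<bar>int_decode i\<bar> \<le> M \<longleftrightarrow> \<bar>int_decode j\<bar> \<le> M")
    case True
    then have "u i = 1 \<and> u j = 1 \<or> translate z v i = 1 \<and> translate z v j = 1"
      using ij unfolding x_def by (metis zero_neq_one)
    then show ?thesis using uv(1) v' ij(3) unfolding spacing_shift_def by blast
  next
    case False
    then consider "\<bar>int_decode i\<bar> \<le> M" "\<bar>int_decode j - z\<bar> \<le> M"
      | "\<bar>int_decode j\<bar> \<le> M" "\<bar>int_decode i - z\<bar> \<le> M"
      using ij(1,2) unfolding x_def by (metis zero_neq_one)
    then show ?thesis
    proof cases
      case 1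
      from sym[OF mixed[OF 1]] show ?thesis by simp
    next
      case 2
      then show ?thesis by (rule mixed)
    qed
  qed
  moreover have "x i \<in> {0, 1}" for i
    using uv(1) v' by (auto simp: x_def spacing_shift_def)
  ultimately have "x \<in> spacing_shift P" unfolding spacing_shift_def by blast
  moreover have "x i = u i \<and> translate (- z) x i = v i" if "\<bar>int_decode i\<bar> \<le> M" for i
  proof -
    have "\<not> \<bar>int_decode i + z\<bar> \<le> M" using that z(2) by linarith
    then show ?thesis using that by (simp add: x_def translate_def)
  qed
  ultimately show ?thesis by blast
qed

text \<open>
  All \<open>k\<close> coordinates are glued with the same distance \<open>z\<close>, so one group element, translation
  by \<open>-z\<close>, moves the glued tuple from \<open>U\<close> into \<open>V\<close>.
\<close>

lemma spacing_shift_highly_transitive: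
  assumes sym: "\<And>p. p \<in> P \<Longrightarrow> - p \<in> P"
    and thick: "\<And>M. \<exists>z>M. {z - M..z + M} \<subseteq> P"
  shows "highly_topologically_transitive Zn (top_of_set (spacing_shift P)) (spacing_action P)"
  unfolding highly_topologically_transitive_def topologically_transitive_def
proof (intro allI impI, elim conjE)
  fix k U V
  let ?K = "spacing_shift P" and ?Xk = "power_space k (top_of_set (spacing_shift P))"
  let ?D = "diagonal_action k (top_of_set (spacing_shift P)) (spacing_action P)"
  assume open_UV: "openin ?Xk U" "openin ?Xk V" and "U \<noteq> {}" "V \<noteq> {}"
  then obtain u v where uv: "u \<in> U" "v \<in> V" by blast
  have top: "topspace ?Xk = (\<Pi>\<^sub>E j\<in>{..<k}. ?K)" by (simp add: power_space_def)
  have uvK: "u j \<in> ?K" "v j \<in> ?K" if "j < k" for j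
    using uv openin_subset[OF open_UV(1)] openin_subset[OF open_UV(2)] that unfolding top by auto
  obtain M1 where M1: "\<And>x. x \<in> topspace ?Xk \<Longrightarrow>
      (\<And>j i. j < k \<Longrightarrow> \<bar>int_decode i\<bar> \<le> M1 \<Longrightarrow> x j i = u j i) \<Longrightarrow> x \<in> U"
    using power_open_contains_window[OF open_UV(1) uv(1)] by blast
  obtain M2 where M2: "\<And>x. x \<in> topspace ?Xk \<Longrightarrow>
      (\<And>j i. j < k \<Longrightarrow> \<bar>int_decode i\<bar> \<le> M2 \<Longrightarrow> x j i = v j i) \<Longrightarrow> x \<in> V"
    using power_open_contains_window[OF open_UV(2) uv(2)] by blast
  define M where "M = max M1 M2"
  obtain z where z: "z > 2 * M" "{z - 2 * M..z + 2 * M} \<subseteq> P" using thick by blast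
  have "\<exists>x\<in>?K. \<forall>i. \<bar>int_decode i\<bar> \<le> M \<longrightarrow> x i = u j i \<and> translate (- z) x i = v j i"
    if "j < k" for j
    using spacing_shift_glue[OF uvK[OF that] sym z(2) z(1)] by blast
  then obtain y where y: "\<And>j. j < k \<Longrightarrow> y j \<in> ?K"
    "\<And>j i. j < k \<Longrightarrow> \<bar>int_decode i\<bar> \<le> M \<Longrightarrow> y j i = u j i \<and> translate (- z) (y j) i = v j i"
    by metis
  define x where "x = restrict y {..<k}"
  define g where "g = int_encode (- z)"
  have x: "x \<in> topspace ?Xk" using y(1) by (auto simp: top x_def)
  have gx: "?D g x = (\<lambda>j\<in>{..<k}. translate (- z) (y j))"
    using x y(1) by (auto simp: diagonal_action_def spacing_action_def g_def x_def)
  have "x \<in> U"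
    using M1[OF x] y(2) by (auto simp: x_def M_def)
  moreover have "?D g x \<in> V"
  proof (rule M2)
    show "?D g x \<in> topspace ?Xk"
      using y(1) translate_spacing_shift unfolding gx by (auto simp: top)
  qed (use y(2) in \<open>auto simp: gx M_def\<close>)
  ultimately have "?D g ` U \<inter> V \<noteq> {}" by blast
  then show "hitting_set Zn ?D U V \<noteq> {}" unfolding hitting_set_def Zn_simps by blast
qed

definition marked :: "int set \<Rightarrow> (nat \<Rightarrow> real) set" where
  "marked P = {x \<in> spacing_shift P. x (int_encode 0) = 1}"

lemma openin_marked: "openin (top_of_set (spacing_shift P)) (marked P)"
proof -
  \<comment> \<open>A symbol is \<open>1\<close> exactly if it exceeds \<open>1/2\<close>, which is an open condition.\<close>
  have "open ((\<lambda>x :: nat \<Rightarrow> real. x (int_encode 0)) -` {1/2<..})"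
    by (intro open_vimage continuous_on_product_coordinates) simp
  moreover have "marked P = spacing_shift P \<inter> (\<lambda>x. x (int_encode 0)) -` {1/2<..}"
  proof (intro equalityI subsetI)
    fix x assume x: "x \<in> spacing_shift P \<inter> (\<lambda>x. x (int_encode 0)) -` {1/2<..}"
    then have "x (int_encode 0) \<in> {0, 1}" unfolding spacing_shift_def by blast
    with x show "x \<in> marked P" by (auto simp: marked_def)
  qed (simp add: marked_def)
  ultimately show ?thesis by (auto simp: openin_open)
qed

lemma marked_nonempty: "marked P \<noteq> {}"
proof -
  have "(\<lambda>i. if i = int_encode 0 then 1 else 0) \<in> marked P"
    by (auto simp: marked_def spacing_shift_def)
  then show ?thesis by blast
qed

text \<open>
  If \<open>x\<close> and its translate by \<open>g\<close> both have a \<open>1\<close> at the origin, then \<open>x\<close> has a \<open>1\<close> at \<open>0\<close> and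
  at \<open>-g\<close>, and the spacing of these two is \<open>g\<close>.
\<close>

lemma hitting_set_marked:
  assumes "g \<in> hitting_set Zn (spacing_action P) (marked P) (marked P)"
  shows "int_decode g = 0 \<or> int_decode g \<in> P"
proof -
  obtain x where x: "x \<in> spacing_shift P" "x (int_encode 0) = 1" "x (int_encode (- int_decode g)) = 1"
    using assms by (auto simp: hitting_set_def marked_def spacing_action_def translate_def)
  have "int_decode (int_encode 0) - int_decode (int_encode (- int_decode g)) \<in> P"
    if "int_encode 0 \<noteq> int_encode (- int_decode g)"
    using x that unfolding spacing_shift_def by blast
  then show ?thesis by (cases "int_decode g = 0") (auto simp: int_encode_eq)
qed

section \<open>A thick set with large gaps\<close>

text \<open>
  The walk needs \<open>4m\<^sup>2\<close> steps to leave \<open>[-m, m]\<close> with a definite probability. For the end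
  \<open>m = 2a\<close> of a block that starts at \<open>a\<close> these are \<open>16a\<^sup>2\<close> steps, and the factor \<open>17\<close> puts the next
  block strictly out of their reach.
\<close>

primrec block_start :: "nat \<Rightarrow> nat" where
  "block_start 0 = 1"
| "block_start (Suc k) = 17 * block_start k ^ 2"

definition sparse_blocks :: "int set" where
  "sparse_blocks = {z. \<exists>k. int (block_start k) \<le> \<bar>z\<bar> \<and> \<bar>z\<bar> \<le> 2 * int (block_start k)}"

lemma block_start_pos: "0 < block_start k"
  by (induction k) auto

lemma block_start_Suc_gt: "16 * block_start k ^ 2 < block_start (Suc k)"
  using block_start_pos[of k] by simp

lemma strict_mono_block_start: "strict_mono block_start"
proof (rule strict_monoI_Suc)
  fix k
  have "block_start k \<le> block_start k ^ 2" by (simp add: power2_eq_square)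
  then show "block_start k < block_start (Suc k)" using block_start_Suc_gt[of k] by linarith
qed

lemma sparse_blocks_thick: "\<exists>z>M. {z - M..z + M} \<subseteq> sparse_blocks"
proof -
  define k where "k = nat (2 * \<bar>M\<bar>)"
  have "k \<le> block_start k" by (rule strict_mono_imp_increasing[OF strict_mono_block_start])
  then have k: "2 * \<bar>M\<bar> \<le> int (block_start k)" by (simp add: k_def)
  show ?thesis
  proof (intro exI conjI subsetI)
    show "M < int (block_start k) + \<bar>M\<bar>" using block_start_pos[of k] by simp
    fix y assume "y \<in> {int (block_start k) + \<bar>M\<bar> - M..int (block_start k) + \<bar>M\<bar> + M}"
    then show "y \<in> sparse_blocks"
      unfolding sparse_blocks_def using k by (intro CollectI exI[of _ k]) auto
  qed
qed

lemma sparse_blocks_gap: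
  assumes "z \<in> sparse_blocks" "\<bar>z\<bar> \<le> 16 * int (block_start k) ^ 2"
  shows "\<bar>z\<bar> \<le> 2 * int (block_start k)"
proof -
  obtain l where l: "int (block_start l) \<le> \<bar>z\<bar>" "\<bar>z\<bar> \<le> 2 * int (block_start l)"
    using assms(1) by (auto simp: sparse_blocks_def)
  have "int (block_start l) \<le> int (16 * block_start k ^ 2)" using assms(2) l(1) by simp
  then have "block_start l \<le> 16 * block_start k ^ 2" by (simp only: of_nat_le_iff)
  then have "block_start l < block_start (Suc k)" using block_start_Suc_gt[of k] by linarith
  then have "l \<le> k" by (simp only: strict_mono_less[OF strict_mono_block_start] less_Suc_eq_le)
  then have "block_start l \<le> block_start k"
    by (simp add: strict_mono_less_eq[OF strict_mono_block_start])
  then show ?thesis using l(2) by linarith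
qed

lemma sparse_blocks_not_mixing:
  "\<not> topologically_mixing Zn (pmf_of_set unit_steps) (top_of_set (spacing_shift sparse_blocks))
     (spacing_action sparse_blocks)"
proof
  let ?N = "hitting_set Zn (spacing_action sparse_blocks) (marked sparse_blocks) (marked sparse_blocks)"
  let ?t = "\<lambda>k. 16 * block_start k ^ 2"
  assume "topologically_mixing Zn (pmf_of_set unit_steps) (top_of_set (spacing_shift sparse_blocks))
     (spacing_action sparse_blocks)"
  then have "(\<lambda>n. measure_pmf.prob (walk n) ?N) \<longlonglongrightarrow> 1"
    unfolding topologically_mixing_def
    by (elim allE[of _ "marked sparse_blocks"] impE) (simp_all add: openin_marked marked_nonempty)
  moreover have "strict_mono ?t"
    using strict_mono_block_start by (auto simp: strict_mono_def power_strict_mono)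
  \<comment> \<open>It suffices to look along the times \<open>16a\<^sub>k\<^sup>2\<close>.\<close>
  ultimately have lim: "(\<lambda>k. measure_pmf.prob (walk (?t k)) ?N) \<longlonglongrightarrow> 1"
    using LIMSEQ_subseq_LIMSEQ[of "\<lambda>n. measure_pmf.prob (walk n) ?N" 1 ?t] by (simp add: o_def)
  have bound: "measure_pmf.prob (walk (?t k)) ?N \<le> 4 / 5" for k
  proof -
    have "measure_pmf.prob (walk (?t k)) ?N \<le>
        measure_pmf.prob (walk (?t k)) {g. \<bar>int_decode g\<bar> \<le> 2 * int (block_start k)}"
    proof (rule measure_pmf.finite_measure_mono_AE)
      show "AE g in measure_pmf (walk (?t k)).
          g \<in> ?N \<longrightarrow> g \<in> {g. \<bar>int_decode g\<bar> \<le> 2 * int (block_start k)}"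
      proof (rule AE_pmfI, intro impI CollectI)
        fix g assume g: "g \<in> set_pmf (walk (?t k))" "g \<in> ?N"
        have "\<bar>int_decode g\<bar> \<le> 16 * int (block_start k) ^ 2" using walk_bounded[OF g(1)] by simp
        then show "\<bar>int_decode g\<bar> \<le> 2 * int (block_start k)"
          using hitting_set_marked[OF g(2)] sparse_blocks_gap by auto
      qed
    qed simp
    also have "\<dots> \<le> 4 / 5"
      using block_start_pos[of k] by (intro walk_anticoncentration) (auto simp: power_mult_distrib)
    finally show ?thesis .
  qed
  have "(1 :: real) \<le> 4 / 5"
    by (rule LIMSEQ_le_const2[OF lim]) (intro exI[of _ 0] allI impI bound)
  then show False by simp
qed

theorem proposition3p4:
  "\<exists>(G :: nat monoid) (A :: nat set) (X :: (nat \<Rightarrow> real) topology)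
     (\<phi> :: nat \<Rightarrow> (nat \<Rightarrow> real) \<Rightarrow> (nat \<Rightarrow> real)).
     group G \<and> finite A \<and> A \<noteq> {} \<and> symmetric_subset G A \<and> generate G A = carrier G \<and>
     compact_space X \<and> polish_space X \<and>
     acts_by_homeomorphisms G X \<phi> \<and>
     highly_topologically_transitive G X \<phi> \<and>
     \<not> topologically_mixing G (pmf_of_set A) X \<phi>"
proof (intro exI conjI)
  show "highly_topologically_transitive Zn (top_of_set (spacing_shift sparse_blocks))
      (spacing_action sparse_blocks)"
    by (rule spacing_shift_highly_transitive[OF _ sparse_blocks_thick]) (simp add: sparse_blocks_def)
qed (fact group_Zn finite_unit_steps unit_steps_nonempty symmetric_unit_steps generate_unit_steps compact_spacing_shift
      polish_spacing_shift spacing_shift_acts sparse_blocks_not_mixing)+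

end
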